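(* There is an absolute constant $C>0$ such that for every access sequence $X=(x_1,\dots,x_m)\in[n]^m$ in which no key value appears twice, and for every reference tree $\mathcal{T}$ for $G_X$, we have $\mathsf{Alt}_\mathcal{T}(X)\le C\,(\mathsf{Funnel}(X)+m)$.
   Context: Geometric view: for $X=(x_1,\dots,x_m)$ let $G_X=\{(x_i,i): i\in[m]\}\subset\mathbb{R}^2$. For a point $p$ write $p.x,p.y$ for its coordinates, and for a set $P$ write $P.x=\{p.x:p\in P\}$, $P.y=\{p.y:p\in P\}$. Mixing value: for disjoint finite sets $L,R\subset\mathbb{R}$, $\mathrm{mix}(L,R)\in\{\mathtt{L},\mathtt{R}\}^*$ is the word obtained by listing $L\cup R$ in increasing order and writing $\mathtt{L}$ for elements of $L$ and $\mathtt{R}$ for elements of $R$; $\mathrm{blocks}(s)$ is $0$ for the empty word and otherwise $1+\#\{i: s_i\ne s_{i+1}\}$ (the number of maximal runs of equal letters); $\mathrm{mixValue}(L,R)=\mathrm{blocks}(\mathrm{mix}(L,R))$. Alternation bound: let $P$ be a finite point set with distinct $y$-coordinates. A reference tree for $P$ is a binary tree in which every non-leaf node has exactly two children and whose leaves are labeled by the elements of $P.x$ in increasing left-to-right order. If $\mathcal{T}$ is a single node, $\mathsf{Alt}_\mathcal{T}(P)=0$. Otherwise, with left/right subtrees $\mathcal{T}_L,\mathcal{T}_R$ of the root, let $P_L=\{p\in P: p.x \text{ labels a leaf of } \mathcal{T}_L\}$, $P_R$ analogously, and $\mathsf{Alt}_\mathcal{T}(P)=\mathrm{mixValue}(P_L.y,P_R.y)+\mathsf{Alt}_{\mathcal{T}_L}(P_L)+\mathsf{Alt}_{\mathcal{T}_R}(P_R)$.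 Set $\mathsf{Alt}_\mathcal{T}(X)=\mathsf{Alt}_\mathcal{T}(G_X)$. Funnel bound: for points $p,q$, $\mathrm{rect}(p,q)=[\min(p.x,q.x),\max(p.x,q.x)]\times[\min(p.y,q.y),\max(p.y,q.y)]$. For $p\in P$, the left funnel $F_L(P,p)$ is the set of $q\in P$ with $q.y<p.y$, $q.x<p.x$ and $P\cap\mathrm{rect}(p,q)=\{p,q\}$; the right funnel $F_R(P,p)$ is defined the same way with $q.x>p.x$. Let $f(P,p)=\mathrm{mixValue}(F_L(P,p).y,F_R(P,p).y)$ and $\mathsf{Funnel}(P)=\sum_{p\in P}f(P,p)$; $\mathsf{Funnel}(X)=\mathsf{Funnel}(G_X)$. *)

theory Defs
  imports Complex_Main
begin

type_synonym point = "real \<times> real"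

text \<open>The sequence is indexed from 1, while list positions are indexed from 0.\<close>

definition points :: "nat list \<Rightarrow> point set" where
  "points X = {(real (X ! (i - 1)), real i) | i. i \<in> {1..length X}}"

datatype letter = L_letter | R_letter

text \<open>Only meaningful for finite disjoint sets.\<close>

definition mix :: "real set \<Rightarrow> real set \<Rightarrow> letter list" where
  "mix L R = map (\<lambda>z. if z \<in> L then L_letter else R_letter) (sorted_list_of_set (L \<union> R))"

definition blocks :: "'a list \<Rightarrow> nat" where
  "blocks s = (if s = [] then 0 else 1 + card {i. Suc i < length s \<and> s ! i \<noteq> s ! Suc i})"

definition mix_value :: "real set \<Rightarrow> real set \<Rightarrow> nat" where
  "mix_value L R = blocks (mix L R)"

datatype leaf_tree = Leaf real | Node leaf_tree leaf_tree

fun leaves :: "leaf_tree \<Rightarrow> real list" where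
  "leaves (Leaf x) = [x]"
| "leaves (Node l r) = leaves l @ leaves r"

definition reference_tree :: "leaf_tree \<Rightarrow> point set \<Rightarrow> bool" where
  "reference_tree T P \<longleftrightarrow> sorted_wrt (<) (leaves T) \<and> set (leaves T) = fst ` P"

fun alt :: "leaf_tree \<Rightarrow> point set \<Rightarrow> nat" where
  "alt (Leaf x) P = 0"
| "alt (Node l r) P =
    (let PL = {p \<in> P. fst p \<in> set (leaves l)};
         PR = {p \<in> P. fst p \<in> set (leaves r)}
     in mix_value (snd ` PL) (snd ` PR) + alt l PL + alt r PR)"

definition rect :: "point \<Rightarrow> point \<Rightarrow> point set" where
  "rect p q = {min (fst p) (fst q)..max (fst p) (fst q)} \<times> {min (snd p) (snd q)..max (snd p) (snd q)}"

definition left_funnel :: "point set \<Rightarrow> point \<Rightarrow> point set" where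
  "left_funnel P p = {q \<in> P. snd q < snd p \<and> fst q < fst p \<and> P \<inter> rect p q = {p, q}}"

definition right_funnel :: "point set \<Rightarrow> point \<Rightarrow> point set" where
  "right_funnel P p = {q \<in> P. snd q < snd p \<and> fst q > fst p \<and> P \<inter> rect p q = {p, q}}"

definition funnel :: "point set \<Rightarrow> nat" where
  "funnel P = (\<Sum>p\<in>P. mix_value (snd ` left_funnel P p) (snd ` right_funnel P p))"

end

theory Submission
  imports Defs
begin

text \<open>
  Call \<open>(a, b)\<close> a crossing at a node of the tree if \<open>a\<close> lies in the left and \<open>b\<close> in the right subtree
  and \<open>b\<close> is the next access after \<open>a\<close> within the key range of the node. Up to a factor 2 and an
  additive constant per node, the alternations of the tree are its crossings.

  Call \<open>(a, c, d, b)\<close> a pinwheel if these points have times \<open>a < c < d < b\<close>, keys \<open>d < a < b < c\<close>, and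
  their bounding box contains no further point. The pinwheels ending at \<open>b\<close> are the left-right-left
  alternations of the funnel of \<open>b\<close>, so there are at most \<open>funnel P\<close> of them.

  Discard the crossings with the latest start into each point and those with the earliest end out of
  each point. For a remaining crossing \<open>(a, b)\<close>, let \<open>(d, b)\<close> be the crossing into \<open>b\<close> with the next
  later start and \<open>(a, c)\<close> the crossing out of \<open>a\<close> with the next earlier end. The nodes of these two
  are nested. If the node of \<open>(d, b)\<close> is the outer one, some pinwheel ends at \<open>b\<close> and starts in the time
  interval from \<open>a\<close> to \<open>d\<close>; otherwise, by rotating the plane by 180 degrees, some pinwheel starts at
  \<open>a\<close> and ends in the time interval from \<open>c\<close> to \<open>b\<close>. Each pinwheel is charged
  at most once in either way.
\<close>

section \<open>Mixing values counted by ascents\<close>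

text \<open>These are the places where an L is directly followed by an R in the mixing word, each
  represented by the value that carries the R.\<close>

definition ascents :: "real set \<Rightarrow> real set \<Rightarrow> real set" where
  "ascents L R = {v \<in> R. \<exists>u\<in>L. u < v \<and> (\<forall>t\<in>L \<union> R. \<not> (u < t \<and> t < v))}"

lemma blocks_snoc:
  "blocks (s @ [x]) = blocks s + (if s \<noteq> [] \<and> last s = x then 0 else 1)"
proof (cases "s = []")
  case True
  then show ?thesis by (simp add: blocks_def)
next
  case False
  let ?D = "\<lambda>s. {i. Suc i < length s \<and> s ! i \<noteq> s ! Suc i}"
  have fin: "finite (?D s)"
    by (rule finite_subset[of _ "{..<length s}"]) auto
  have "?D (s @ [x]) = ?D s \<union> (if last s = x then {} else {length s - 1})" (is "?A = ?B")
  proof (rule set_eqI)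
    fix i
    consider "Suc i < length s" | "Suc i = length s" | "Suc i > length s" by linarith
    then show "i \<in> ?A \<longleftrightarrow> i \<in> ?B"
    proof cases
      case 2
      then have "i = length s - 1" by simp
      then show ?thesis using 2 False by (auto simp: nth_append last_conv_nth)
    qed (use False in \<open>auto simp: nth_append\<close>)
  qed
  then show ?thesis using False fin by (auto simp: blocks_def)
qed

lemma mix_snoc:
  assumes "finite A" "L \<union> R = insert b A" "\<forall>x\<in>A. x < b"
  shows "mix L R = mix (L - {b}) (R - {b}) @ [if b \<in> L then L_letter else R_letter]"
proof -
  have b: "b \<notin> A" using assms(3) by auto
  have "L - {b} \<union> (R - {b}) = A" using assms(2) b by blast
  moreover have "sorted_list_of_set (insert b A) = sorted_list_of_set A @ [b]"
    using assms b by (simp add: sorted_insort_is_snoc less_imp_le)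
  ultimately show ?thesis
    using assms b by (auto simp: mix_def)
qed

lemma last_mix:
  assumes "finite (L \<union> R)" "L \<union> R \<noteq> {}"
  shows "last (mix L R) = (if Max (L \<union> R) \<in> L then L_letter else R_letter)"
proof -
  let ?b = "Max (L \<union> R)"
  have "?b \<in> L \<union> R" using assms by (rule Max_in)
  then have "L \<union> R = insert ?b (L \<union> R - {?b})" by blast
  moreover have "\<forall>x\<in>L \<union> R - {?b}. x < ?b"
    using assms(1) by (metis DiffD1 DiffD2 Max_ge order_le_less singletonI)
  ultimately show ?thesis
    using mix_snoc[of "L \<union> R - {?b}" L R ?b] assms by simp
qed

lemma mix_eq_Nil_iff: "finite (L \<union> R) \<Longrightarrow> mix L R = [] \<longleftrightarrow> L \<union> R = {}"
  by (auto simp: mix_def)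

text \<open>The maximum is never the smaller end of an ascent, so removing it only affects whether
  it is an ascent itself. Its predecessor is \<open>Max A\<close>, whose side decides this when
  \<open>b \<in> R\<close>.\<close>

lemma ascents_insert_max:
  assumes "finite A" "L \<union> R = insert b A" "\<forall>x\<in>A. x < b" "L \<inter> R = {}"
  shows "ascents L R = ascents (L - {b}) (R - {b}) \<union>
    (if b \<in> R \<and> A \<noteq> {} \<and> Max A \<in> L then {b} else {})" (is "?A = ?B")
proof (rule set_eqI)
  fix v
  show "v \<in> ?A \<longleftrightarrow> v \<in> ?B"
  proof (cases "v = b")
    case True
    have "b \<in> ascents L R \<longleftrightarrow> b \<in> R \<and> A \<noteq> {} \<and> Max A \<in> L"
    proof
      assume "b \<in> ascents L R"
      then obtain u where u: "b \<in> R" "u \<in> L" "u < b" "\<forall>t\<in>L \<union> R. \<not> (u < t \<and> t < b)"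
        by (auto simp: ascents_def)
      have "u \<in> A" using u(2,3) assms(2) by auto
      moreover have "Max A = u"
      proof (rule Max_eqI)
        fix t assume "t \<in> A"
        then have "t \<in> L \<union> R" "t < b" using assms by auto
        then show "t \<le> u" using u(4) by force
      qed (use \<open>u \<in> A\<close> assms in auto)
      ultimately show "b \<in> R \<and> A \<noteq> {} \<and> Max A \<in> L" using u by auto
    next
      assume *: "b \<in> R \<and> A \<noteq> {} \<and> Max A \<in> L"
      then have "Max A < b" using assms Max_in by blast
      moreover have "\<not> (Max A < t \<and> t < b)" if "t \<in> L \<union> R" for t
        using that assms(2) Max_ge[OF assms(1), of t] by (metis insertE leD less_irrefl)
      ultimately show "b \<in> ascents L R" using * unfolding ascents_def by blast
    qed
    then show ?thesis using True by (auto simp: ascents_def)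
  next
    case False
    have "v \<in> ascents L R \<longleftrightarrow> v \<in> ascents (L - {b}) (R - {b})"
    proof (cases "v \<in> R")
      case True
      then have "v < b" using False assms by blast
      then show ?thesis using True unfolding ascents_def
        by (auto; smt (verit) DiffI Un_iff singletonD)
    qed (auto simp: ascents_def)
    then show ?thesis using False by auto
  qed
qed

text \<open>With \<open>k\<close> ascents, a word ending in R consists of an optional leading R-run
  and \<open>k\<close> pairs of an L-run and an R-run, hence has at most \<open>2 * k + 1\<close>
  blocks; a word ending in L has one more run. Separating the two endings makes the induction work:
  an L appended after an R adds a block without an ascent, and an R appended after an L pays this
  back.\<close>

lemma ascents_mix_value_aux:
  assumes "finite S" "L \<union> R = S" "L \<inter> R = {}"
  shows "card (ascents L R) \<le> mix_value L R \<and>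
    mix_value L R \<le> 2 * card (ascents L R) + (if S \<noteq> {} \<and> Max S \<in> R then 1 else 2)"
  using assms
proof (induction S arbitrary: L R rule: finite_linorder_max_induct)
  case empty
  then show ?case by (simp add: ascents_def mix_value_def mix_def blocks_def)
next
  case (insert b A)
  let ?L = "L - {b}" and ?R = "R - {b}"
  have A: "?L \<union> ?R = A" "?L \<inter> ?R = {}" using insert by blast+
  note IH = insert.IH[OF A]
  have fin: "finite (ascents ?L ?R)"
    by (rule finite_subset[of _ A]) (use A insert.hyps in \<open>auto simp: ascents_def\<close>)
  have "b \<notin> ascents ?L ?R" by (auto simp: ascents_def)
  then have card: "card (ascents L R) = card (ascents ?L ?R) +
      (if b \<in> R \<and> A \<noteq> {} \<and> Max A \<in> L then 1 else 0)"
    using ascents_insert_max[OF insert.hyps(1) insert.prems(1) insert.hyps(2) insert.prems(2)] fin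
    by simp
  have last: "last (mix ?L ?R) = (if Max A \<in> ?L then L_letter else R_letter)" if "A \<noteq> {}"
    using last_mix[of ?L ?R] that A insert.hyps(1) by simp
  have nil: "mix ?L ?R = [] \<longleftrightarrow> A = {}"
    using mix_eq_Nil_iff[of ?L ?R] A insert.hyps(1) by simp
  have mv: "mix_value L R = mix_value ?L ?R +
      (if A \<noteq> {} \<and> (Max A \<in> L \<longleftrightarrow> b \<in> L) then 0 else 1)"
  proof -
    have "Max A \<noteq> b" if "A \<noteq> {}" using that insert.hyps Max_in by blast
    then show ?thesis
      unfolding mix_value_def mix_snoc[OF insert.hyps(1) insert.prems(1) insert.hyps(2)] blocks_snoc nil
      using last by (cases "A = {}") auto
  qed
  have max: "Max (insert b A) = b"
    using insert.hyps by (intro Max_eqI) (auto simp: less_imp_le)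
  have b: "b \<in> R \<longleftrightarrow> b \<notin> L" using insert.prems by blast
  show ?case
  proof (cases "A = {}")
    case True
    then have "mix_value ?L ?R = 0" using nil by (simp add: mix_value_def blocks_def)
    moreover have "ascents ?L ?R = {}" using True A by (auto simp: ascents_def)
    ultimately show ?thesis using True mv card by simp
  next
    case False
    then have "Max A \<in> A" using insert.hyps by simp
    then have "Max A \<noteq> b" "Max A \<in> R \<longleftrightarrow> Max A \<notin> L"
      using insert.hyps insert.prems by blast+
    then show ?thesis
      using IH False unfolding mv card max b
      by (cases "b \<in> L"; cases "Max A \<in> L") simp_all
  qed
qed

lemma card_ascents_le_mix_value:
  "finite L \<Longrightarrow> finite R \<Longrightarrow> L \<inter> R = {} \<Longrightarrow> card (ascents L R) \<le> mix_value L R"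
  using ascents_mix_value_aux[of "L \<union> R" L R] by simp

lemma mix_value_le_card_ascents:
  "finite L \<Longrightarrow> finite R \<Longrightarrow> L \<inter> R = {} \<Longrightarrow> mix_value L R \<le> 2 * card (ascents L R) + 2"
  using ascents_mix_value_aux[of "L \<union> R" L R] by (auto split: if_splits)

section \<open>Crossings and the alternation bound\<close>

text \<open>The box is closed in key and open in time, so that points at the two bounding times,
  such as the ends of a crossing, do not spoil it.\<close>

definition box_free :: "point set \<Rightarrow> real \<Rightarrow> real \<Rightarrow> real \<Rightarrow> real \<Rightarrow> bool" where
  "box_free P x1 x2 y1 y2 \<longleftrightarrow>
    (\<forall>q\<in>P. x1 \<le> fst q \<longrightarrow> fst q \<le> x2 \<longrightarrow> y1 < snd q \<longrightarrow> \<not> snd q < y2)"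

text \<open>\<open>P\<close> stays the whole point set throughout the recursion and each node
  selects its points by its own leaves, so crossings at different nodes are pairs over the same
  set.\<close>

fun crossings :: "point set \<Rightarrow> leaf_tree \<Rightarrow> (point \<times> point) set" where
  "crossings P (Leaf x) = {}"
| "crossings P (Node l r) =
    {(a, b). a \<in> P \<and> b \<in> P \<and> fst a \<in> set (leaves l) \<and> fst b \<in> set (leaves r) \<and> snd a < snd b \<and>
      (\<forall>q\<in>P. fst q \<in> set (leaves (Node l r)) \<longrightarrow> \<not> (snd a < snd q \<and> snd q < snd b))}
    \<union> crossings P l \<union> crossings P r"

lemma crossingsD:
  "(a, b) \<in> crossings P T \<Longrightarrow>
    a \<in> P \<and> b \<in> P \<and> fst a \<in> set (leaves T) \<and> fst b \<in> set (leaves T) \<and> snd a < snd b"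
  by (induction T) auto

lemma finite_crossings: "finite P \<Longrightarrow> finite (crossings P T)"
  by (rule finite_subset[of _ "P \<times> P"]) (auto dest: crossingsD)

text \<open>Each inner node contributes at most twice its ascents plus 2, and a tree with
  \<open>k\<close> leaves has \<open>k - 1\<close> inner nodes; the \<open>+ 2\<close> on the left
  expresses this without subtraction.\<close>

lemma alt_le_card_crossings:
  assumes "finite P" "inj_on snd P" "sorted_wrt (<) (leaves T)"
    and "Q = {p \<in> P. fst p \<in> set (leaves T)}"
  shows "alt T Q + 2 \<le> 2 * card (crossings P T) + 2 * length (leaves T)"
  using assms(3,4)
proof (induction T arbitrary: Q)
  case (Leaf x)
  then show ?case by simp
next
  case (Node l r)
  let ?L = "{p \<in> P. fst p \<in> set (leaves l)}" and ?R = "{p \<in> P. fst p \<in> set (leaves r)}"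
  let ?A = "{(a, b). a \<in> P \<and> b \<in> P \<and> fst a \<in> set (leaves l) \<and> fst b \<in> set (leaves r) \<and> snd a < snd b \<and>
      (\<forall>q\<in>P. fst q \<in> set (leaves (Node l r)) \<longrightarrow> \<not> (snd a < snd q \<and> snd q < snd b))}"
  have sub: "{p \<in> Q. fst p \<in> set (leaves l)} = ?L" "{p \<in> Q. fst p \<in> set (leaves r)} = ?R"
    using Node.prems by auto
  have disj: "set (leaves l) \<inter> set (leaves r) = {}"
    using Node.prems(1) by (force simp: sorted_wrt_append)
  have IHl: "alt l ?L + 2 \<le> 2 * card (crossings P l) + 2 * length (leaves l)"
    and IHr: "alt r ?R + 2 \<le> 2 * card (crossings P r) + 2 * length (leaves r)"
    using Node by (auto simp: sorted_wrt_append)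
  have finA: "finite ?A"
    by (rule finite_subset[of _ "P \<times> P"]) (use assms(1) in auto)
  have "snd ` ?L \<inter> snd ` ?R = {}"
    using disj assms(2) by (auto dest: inj_onD)
  then have "mix_value (snd ` ?L) (snd ` ?R) \<le> 2 * card (ascents (snd ` ?L) (snd ` ?R)) + 2"
    using assms(1) by (intro mix_value_le_card_ascents) auto
  \<comment> \<open>An ascent is the time of the later end of a crossing at the root.\<close>
  moreover have "ascents (snd ` ?L) (snd ` ?R) \<subseteq> (\<lambda>(a, b). snd b) ` ?A"
  proof
    fix v assume "v \<in> ascents (snd ` ?L) (snd ` ?R)"
    then obtain a b where "a \<in> ?L" "b \<in> ?R" "v = snd b" "snd a < snd b"
      "\<forall>t\<in>snd ` ?L \<union> snd ` ?R. \<not> (snd a < t \<and> t < snd b)"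
      unfolding ascents_def by blast
    then have "(a, b) \<in> ?A" by auto
    then show "v \<in> (\<lambda>(a, b). snd b) ` ?A" using \<open>v = snd b\<close> by force
  qed
  then have "card (ascents (snd ` ?L) (snd ` ?R)) \<le> card ?A"
    using finA by (meson card_image_le card_mono finite_imageI le_trans)
  \<comment> \<open>A root crossing has its ends in different subtrees, whereas any other crossing
    has both ends in one subtree.\<close>
  moreover have "card (crossings P (Node l r)) = card ?A + card (crossings P l) + card (crossings P r)"
  proof -
    have "?A \<inter> crossings P l = {}" "(?A \<union> crossings P l) \<inter> crossings P r = {}"
      using disj by (auto dest!: crossingsD)
    then show ?thesis
      using finA finite_crossings[OF assms(1)] by (simp only: crossings.simps card_Un_disjoint finite_Un)
  qed
  ultimately show ?case using IHl IHr sub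
    by (simp add: Let_def del: crossings.simps)
qed

section \<open>Empty boxes obtained from crossings\<close>

text \<open>This is the part of being a reference tree that subtrees inherit: the leaves fill an
  interval of the keys of \<open>P\<close>.\<close>

definition gapless :: "point set \<Rightarrow> leaf_tree \<Rightarrow> bool" where
  "gapless P T \<longleftrightarrow> sorted_wrt (<) (leaves T) \<and>
    (\<forall>q\<in>P. \<forall>u\<in>set (leaves T). \<forall>v\<in>set (leaves T).
      u \<le> fst q \<longrightarrow> fst q \<le> v \<longrightarrow> fst q \<in> set (leaves T))"

lemma gapless_Node:
  assumes "gapless P (Node l r)"
  shows "gapless P l" "gapless P r"
    and "\<And>u v. u \<in> set (leaves l) \<Longrightarrow> v \<in> set (leaves r) \<Longrightarrow> u < v"
proof -
  show less: "u < v" if "u \<in> set (leaves l)" "v \<in> set (leaves r)" for u v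
    using assms that by (auto simp: gapless_def sorted_wrt_append)
  have cv: "fst q \<in> set (leaves l) \<union> set (leaves r)"
    if "q \<in> P" "u \<in> set (leaves l) \<union> set (leaves r)" "v \<in> set (leaves l) \<union> set (leaves r)"
      "u \<le> fst q" "fst q \<le> v" for q u v
    using assms that unfolding gapless_def leaves.simps set_append by blast
  have so: "sorted_wrt (<) (leaves l)" "sorted_wrt (<) (leaves r)"
    using assms by (auto simp: gapless_def sorted_wrt_append)
  show "gapless P l" unfolding gapless_def
  proof (intro conjI ballI impI)
    fix q u v assume *: "q \<in> P" "u \<in> set (leaves l)" "v \<in> set (leaves l)" "u \<le> fst q" "fst q \<le> v"
    then have "fst q \<notin> set (leaves r)" using less[of v "fst q"] by auto
    then show "fst q \<in> set (leaves l)" using cv[of q u v] * by blast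
  qed (rule so)
  show "gapless P r" unfolding gapless_def
  proof (intro conjI ballI impI)
    fix q u v assume *: "q \<in> P" "u \<in> set (leaves r)" "v \<in> set (leaves r)" "u \<le> fst q" "fst q \<le> v"
    then have "fst q \<notin> set (leaves l)" using less[of "fst q" u] by auto
    then show "fst q \<in> set (leaves r)" using cv[of q u v] * by blast
  qed (rule so)
qed

text \<open>By gaplessness, every point with key between \<open>u\<close> and \<open>v\<close>
  belongs to the node, so a time gap of the node is an empty box over that key range.\<close>

lemma box_free_root:
  assumes "gapless P T" "u \<in> set (leaves T)" "v \<in> set (leaves T)"
    and "\<And>q. q \<in> P \<Longrightarrow> fst q \<in> set (leaves T) \<Longrightarrow> \<not> (y1 < snd q \<and> snd q < y2)"
  shows "box_free P u v y1 y2"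
  using assms unfolding gapless_def box_free_def by blast

lemma crossings_box_free:
  assumes "gapless P T" "(a, b) \<in> crossings P T"
  shows "fst a < fst b \<and> box_free P (fst a) (fst b) (snd a) (snd b)"
  using assms
proof (induction T)
  case (Node l r)
  note G = gapless_Node[OF Node.prems(1)]
  consider "(a, b) \<in> crossings P l" | "(a, b) \<in> crossings P r"
    | "fst a \<in> set (leaves l)" "fst b \<in> set (leaves r)"
      "\<And>q. q \<in> P \<Longrightarrow> fst q \<in> set (leaves (Node l r)) \<Longrightarrow> \<not> (snd a < snd q \<and> snd q < snd b)"
    using Node.prems(2) by auto
  then show ?case
  proof cases
    case 3
    then show ?thesis
      using G(3) by (auto intro!: box_free_root[OF Node.prems(1)])
  qed (use Node.IH G in auto)
qed simp

text \<open>Descend along the nodes containing both \<open>a\<close> and \<open>b\<close> until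
  \<open>(d, b)\<close> or \<open>(a, c)\<close> is a crossing of the current root. Both
  \<open>d\<close> and \<open>c\<close> are still leaves there, so the time gap of that crossing is
  empty over all keys from \<open>d\<close> to \<open>c\<close>.\<close>

lemma crossings_nested_box_free:
  assumes "gapless P T"
    and "(a, b) \<in> crossings P T" "(d, b) \<in> crossings P T" "(a, c) \<in> crossings P T"
    and "snd a < snd d" "snd c < snd b"
  shows "box_free P (fst d) (fst c) (snd d) (snd b) \<or> box_free P (fst d) (fst c) (snd a) (snd c)"
  using assms(1-4)
proof (induction T)
  case (Node l r)
  note G = gapless_Node[OF Node.prems(1)]
  let ?A = "{(a, b). a \<in> P \<and> b \<in> P \<and> fst a \<in> set (leaves l) \<and> fst b \<in> set (leaves r) \<and> snd a < snd b \<and>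
      (\<forall>q\<in>P. fst q \<in> set (leaves (Node l r)) \<longrightarrow> \<not> (snd a < snd q \<and> snd q < snd b))}"
  have disj: "x \<notin> set (leaves r)" if "x \<in> set (leaves l)" for x
    using G(3) that by blast
  have split: "(p, q) \<in> ?A \<or> (p, q) \<in> crossings P l \<or> (p, q) \<in> crossings P r"
    if "(p, q) \<in> crossings P (Node l r)" for p q
    using that by auto
  have D: "d \<in> P" "fst d \<in> set (leaves (Node l r))" "snd d < snd b"
    and C: "c \<in> P" "fst c \<in> set (leaves (Node l r))"
    using crossingsD Node.prems by blast+
  consider "(a, b) \<in> ?A" | "(a, b) \<in> crossings P l" | "(a, b) \<in> crossings P r"
    using split[OF Node.prems(2)] by blast
  then show ?case
  proof cases
    case 1
    \<comment> \<open>This case is impossible: \<open>d\<close> is a point of the root with time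
      strictly between \<open>a\<close> and \<open>b\<close>.\<close>
    then show ?thesis using D assms(5) by blast
  next
    case 2
    then have ab: "fst a \<in> set (leaves l)" "fst b \<in> set (leaves l)" by (auto dest: crossingsD)
    \<comment> \<open>A crossing of the root ends in the right subtree, so with \<open>b\<close> on
      the left only \<open>(a, c)\<close> can be one.\<close>
    then have "(d, b) \<in> crossings P l"
      using split[OF Node.prems(3)] disj by (auto dest: crossingsD)
    moreover have "(a, c) \<in> ?A \<or> (a, c) \<in> crossings P l"
      using split[OF Node.prems(4)] disj ab by (auto dest: crossingsD)
    ultimately show ?thesis
      using Node.IH(1)[OF G(1) 2] box_free_root[OF Node.prems(1) D(2) C(2), of "snd a" "snd c"] by blast
  next
    case 3
    then have ab: "fst a \<in> set (leaves r)" "fst b \<in> set (leaves r)" by (auto dest: crossingsD)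
    then have "(a, c) \<in> crossings P r"
      using split[OF Node.prems(4)] disj by (auto dest: crossingsD)
    moreover have "(d, b) \<in> ?A \<or> (d, b) \<in> crossings P r"
      using split[OF Node.prems(3)] disj ab by (auto dest: crossingsD)
    ultimately show ?thesis
      using Node.IH(2)[OF G(2) 3] box_free_root[OF Node.prems(1) D(2) C(2), of "snd d" "snd b"] by blast
  qed
qed simp

section \<open>Pinwheels and how to find them\<close>

definition pinwheels :: "point set \<Rightarrow> (point \<times> point \<times> point \<times> point) set" where
  "pinwheels P = {(a, c, d, b). {a, c, d, b} \<subseteq> P \<and>
    fst d < fst a \<and> fst a < fst b \<and> fst b < fst c \<and>
    snd a < snd c \<and> snd c < snd d \<and> snd d < snd b \<and>
    (\<forall>q\<in>P. fst d \<le> fst q \<longrightarrow> fst q \<le> fst c \<longrightarrow> snd a \<le> snd q \<longrightarrow> snd q \<le> snd b \<longrightarrow> q \<in> {a, c, d, b})}"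

lemma pinwheelsD:
  assumes "(a, c, d, b) \<in> pinwheels P"
  shows "a \<in> P" "c \<in> P" "d \<in> P" "b \<in> P"
    and "fst d < fst a" "fst a < fst b" "fst b < fst c"
    and "snd a < snd c" "snd c < snd d" "snd d < snd b"
    and "\<And>q. q \<in> P \<Longrightarrow> fst d \<le> fst q \<Longrightarrow> fst q \<le> fst c \<Longrightarrow> snd a \<le> snd q \<Longrightarrow> snd q \<le> snd b
          \<Longrightarrow> q = a \<or> q = c \<or> q = d \<or> q = b"
  using assms unfolding pinwheels_def by simp_all

lemma finite_pinwheels: "finite P \<Longrightarrow> finite (pinwheels P)"
  by (rule finite_subset[of _ "P \<times> P \<times> P \<times> P"]) (auto simp: pinwheels_def)

text \<open>Values are real so that maximizers are obtained from the negated coordinate.\<close>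

lemma finite_ex_minimizer:
  fixes f :: "'a \<Rightarrow> real"
  assumes "finite S" "s \<in> S"
  shows "\<exists>m\<in>S. \<forall>q\<in>S. f m \<le> f q"
proof (intro bexI ballI)
  have "S \<noteq> {}" using assms by blast
  then show "arg_min_on f S \<in> S" using assms(1) by (rule arg_min_if_finite(1)[rotated])
  show "f (arg_min_on f S) \<le> f q" if "q \<in> S" for q
    using arg_min_least[OF assms(1) \<open>S \<noteq> {}\<close> that] .
qed

text \<open>The four points have the right shape, but their bounding box may contain others. It is
  shrunk in three dependent choices: \<open>c'\<close> leftmost to the right of \<open>b\<close>,
  then \<open>d'\<close> rightmost up to the key of \<open>a\<close> and later than
  \<open>c'\<close>, then \<open>a'\<close> latest before \<open>c'\<close> among the keys from
  \<open>d'\<close> to \<open>a\<close>.\<close>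

lemma pinwheel_ending_at:
  assumes fin: "finite P" and inj: "inj_on fst P" "inj_on snd P"
    and P: "a \<in> P" "b \<in> P" "c \<in> P" "d \<in> P"
    and x: "fst d < fst a" "fst a < fst b" "fst b < fst c"
    and y: "snd a < snd c" "snd c < snd d" "snd d < snd b"
    and f1: "box_free P (fst a) (fst b) (snd a) (snd b)"
    and f2: "box_free P (fst d) (fst c) (snd d) (snd b)"
  obtains a' c' d' where "(a', c', d', b) \<in> pinwheels P" "snd a \<le> snd a'" "snd a' < snd d"
proof -
  have eqx: "q = r" if "q \<in> P" "r \<in> P" "fst q = fst r" for q r by (rule inj_onD[OF inj(1) that(3,1,2)])
  have eqy: "q = r" if "q \<in> P" "r \<in> P" "snd q = snd r" for q r by (rule inj_onD[OF inj(2) that(3,1,2)])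
  let ?C = "{q \<in> P. fst b < fst q \<and> fst q \<le> fst c \<and> snd a < snd q \<and> snd q < snd d}"
  have "finite ?C" "c \<in> ?C" using fin P x y by auto
  then obtain c' where c': "c' \<in> ?C" "\<And>q. q \<in> ?C \<Longrightarrow> fst c' \<le> fst q"
    using finite_ex_minimizer[of ?C c fst] by blast
  let ?D = "{q \<in> P. fst d \<le> fst q \<and> fst q \<le> fst a \<and> snd c' < snd q \<and> snd q \<le> snd d}"
  have "finite ?D" "d \<in> ?D" using fin P x y c'(1) by auto
  then obtain d' where d': "d' \<in> ?D" "\<And>q. q \<in> ?D \<Longrightarrow> - fst d' \<le> - fst q"
    using finite_ex_minimizer[of ?D d "\<lambda>q. - fst q"] by blast
  have d'a: "fst d' < fst a" using eqx[of d' a] d'(1) c'(1) P by force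
  let ?A = "{q \<in> P. fst d' < fst q \<and> fst q \<le> fst a \<and> snd a \<le> snd q \<and> snd q < snd c'}"
  have "finite ?A" "a \<in> ?A" using fin P x y c'(1) d'a by auto
  then obtain a' where a': "a' \<in> ?A" "\<And>q. q \<in> ?A \<Longrightarrow> - snd a' \<le> - snd q"
    using finite_ex_minimizer[of ?A a "\<lambda>q. - snd q"] by blast
  have "q \<in> {a', c', d', b}"
    if q: "q \<in> P" "fst d' \<le> fst q" "fst q \<le> fst c'" "snd a' \<le> snd q" "snd q \<le> snd b" for q
  proof (rule ccontr)
    assume "q \<notin> {a', c', d', b}"
    then have ne: "fst q \<noteq> fst d'" "fst q \<noteq> fst c'" "snd q \<noteq> snd a'" "snd q \<noteq> snd b" "snd q \<noteq> snd c'"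
      "fst q \<noteq> fst b"
      using eqx[of q d'] eqx[of q c'] eqx[of q b] eqy[of q a'] eqy[of q b] eqy[of q c']
        q(1) P c'(1) d'(1) a'(1) by auto
    \<comment> \<open>No point of the box other than \<open>b\<close> is later than
      \<open>d\<close>, by \<open>f2\<close>. Up to the key of \<open>a\<close>, an intruder
      contradicts the choice of \<open>a'\<close> or \<open>d'\<close>; between \<open>a\<close> and
      \<open>b\<close> it contradicts \<open>f1\<close>, and beyond \<open>b\<close> the choice of
      \<open>c'\<close>.\<close>
    have late: "snd q \<le> snd d"
      using f2 q ne d'(1) c'(1) unfolding box_free_def by force
    show False
    proof (cases "fst q \<le> fst a")
      case True
      have "q \<notin> ?A" using a'(2)[of q] q(4) ne(3) by linarith
      moreover have "q \<notin> ?D" using d'(2)[of q] q(2) ne(1) by linarith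
      ultimately show False using True q ne late d'(1) a'(1) by auto
    next
      case False
      have "\<not> fst q \<le> fst b"
        using f1 False q ne a'(1) unfolding box_free_def by force
      moreover have "q \<notin> ?C" using c'(2)[of q] q(3) ne(2) by linarith
      moreover have "snd q \<noteq> snd d" using eqy[of q d] q(1) P x calculation by force
      ultimately show False using q ne late c'(1) a'(1) by auto
    qed
  qed
  then have "(a', c', d', b) \<in> pinwheels P"
    using a'(1) c'(1) d'(1) x y P unfolding pinwheels_def by auto
  then show thesis using that[of a' c' d'] a'(1) c'(1) by auto
qed

section \<open>Pinwheels counted by the funnel bound\<close>

text \<open>In a pinwheel ending at \<open>b\<close>, the point \<open>a\<close> is in the left
  funnel of \<open>b\<close>, \<open>c\<close> in the right one, and no funnel time separates them.
  So the time of \<open>c\<close> is an ascent, and it determines the pinwheel.\<close>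

lemma card_pinwheels_le_funnel:
  assumes fin: "finite P" and inj: "inj_on fst P" "inj_on snd P"
  shows "card (pinwheels P) \<le> funnel P"
proof -
  have eqx: "q = r" if "q \<in> P" "r \<in> P" "fst q = fst r" for q r by (rule inj_onD[OF inj(1) that(3,1,2)])
  have eqy: "q = r" if "q \<in> P" "r \<in> P" "snd q = snd r" for q r by (rule inj_onD[OF inj(2) that(3,1,2)])
  let ?W = "\<lambda>b. {z \<in> pinwheels P. \<exists>a c d. z = (a, c, d, b)}"
  let ?L = "\<lambda>b. snd ` left_funnel P b" and ?R = "\<lambda>b. snd ` right_funnel P b"
  have "pinwheels P = (\<Union>b\<in>P. ?W b)" by (auto simp: pinwheels_def)
  then have "card (pinwheels P) \<le> (\<Sum>b\<in>P. card (?W b))"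
    using card_UN_le[OF fin, of ?W] by simp
  also have "\<dots> \<le> (\<Sum>b\<in>P. mix_value (?L b) (?R b))"
  proof (rule sum_mono)
    fix b assume b: "b \<in> P"
    have sub: "left_funnel P b \<subseteq> P" "right_funnel P b \<subseteq> P"
      by (auto simp: left_funnel_def right_funnel_def)
    then have finLR: "finite (?L b)" "finite (?R b)" using fin finite_subset by blast+
    have disj: "?L b \<inter> ?R b = {}"
    proof (rule ccontr)
      assume "?L b \<inter> ?R b \<noteq> {}"
      then obtain p q where "p \<in> left_funnel P b" "q \<in> right_funnel P b" "snd p = snd q" by auto
      moreover from this have "p = q" using sub eqy by blast
      ultimately show False by (auto simp: left_funnel_def right_funnel_def)
    qed
    have "card (?W b) \<le> card (ascents (?L b) (?R b))"
    \<comment> \<open>The relation sends \<open>(a, c, d, b)\<close> to the time of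
      \<open>c\<close>.\<close>
    proof (rule card_le_if_inj_on_rel[where r = "\<lambda>z v. v = snd (fst (snd z))"])
      show "finite (ascents (?L b) (?R b))"
        by (rule finite_subset[OF _ finLR(2)]) (auto simp: ascents_def)
    next
      fix z assume "z \<in> ?W b"
      then obtain a c d where z: "z = (a, c, d, b)" "(a, c, d, b) \<in> pinwheels P" by blast
      note P = pinwheelsD(1-3)[OF z(2)] and x = pinwheelsD(5-7)[OF z(2)]
        and y = pinwheelsD(8-10)[OF z(2)] and e = pinwheelsD(11)[OF z(2)]
      have "P \<inter> rect b a = {b, a}"
      proof -
        have "q = a \<or> q = b" if "q \<in> P" "q \<in> rect b a" for q
          using e[of q] that x y by (auto simp: rect_def)
        moreover have "{b, a} \<subseteq> rect b a" by (auto simp: rect_def mem_Times_iff)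
        ultimately show ?thesis using b P by auto
      qed
      then have aL: "a \<in> left_funnel P b" using P x y by (auto simp: left_funnel_def)
      have "P \<inter> rect b c = {b, c}"
      proof -
        have "q = c \<or> q = b" if "q \<in> P" "q \<in> rect b c" for q
          using e[of q] that x y by (auto simp: rect_def)
        moreover have "{b, c} \<subseteq> rect b c" by (auto simp: rect_def mem_Times_iff)
        ultimately show ?thesis using b P by auto
      qed
      then have cR: "c \<in> right_funnel P b" using P x y by (auto simp: right_funnel_def)
      have "\<not> (snd a < snd q \<and> snd q < snd c)" if q: "q \<in> left_funnel P b \<union> right_funnel P b" for q
      proof
        assume t: "snd a < snd q \<and> snd q < snd c"
        have qP: "q \<in> P" "P \<inter> rect b q = {b, q}"
          using q by (auto simp: left_funnel_def right_funnel_def)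
        \<comment> \<open>A funnel point this early has no room outside the keys from
          \<open>d\<close> to \<open>c\<close>, since its rectangle to \<open>b\<close> would
          contain \<open>d\<close> or \<open>c\<close>. It therefore lies in the empty box of the
          pinwheel.\<close>
        have "d \<notin> rect b q" "c \<notin> rect b q" using qP(2) P t x y by auto
        then have "fst d \<le> fst q" "fst q \<le> fst c"
          using t x y by (auto simp: rect_def mem_Times_iff)
        then show False using e[OF qP(1)] t x y by auto
      qed
      then have "snd c \<in> ascents (?L b) (?R b)"
        using aL cR y unfolding ascents_def by blast
      then show "\<exists>v. v \<in> ascents (?L b) (?R b) \<and> v = snd (fst (snd z))" using z by auto
    next
      fix z z' v
      assume "z \<in> ?W b" "z' \<in> ?W b" "v = snd (fst (snd z))" "v = snd (fst (snd z'))"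
      then obtain a c d a' c' d' where z: "z = (a, c, d, b)" "(a, c, d, b) \<in> pinwheels P"
        "z' = (a', c', d', b)" "(a', c', d', b) \<in> pinwheels P" "snd c = snd c'" by auto
      note w = pinwheelsD[OF z(2)] and w' = pinwheelsD[OF z(4)]
      have "c = c'" by (rule eqy[OF w(2) w'(2) z(5)])
      \<comment> \<open>Otherwise the \<open>d\<close>-point further right lies in the box of the
        other pinwheel. Once these agree, the later \<open>a\<close>-point likewise lies in the
        other box.\<close>
      have "fst d = fst d'"
      proof (rule ccontr)
        assume "fst d \<noteq> fst d'"
        then consider "fst d < fst d'" | "fst d' < fst d" by linarith
        then show False
        proof cases
          case 1
          then have "d' = a \<or> d' = c \<or> d' = d \<or> d' = b"
            using w(5-10) w'(5-10) \<open>c = c'\<close> by (intro w(11)[OF w'(3)]) auto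
          then show False using 1 w(5-10) w'(5-10) \<open>c = c'\<close> by auto
        next
          case 2
          then have "d = a' \<or> d = c' \<or> d = d' \<or> d = b"
            using w(5-10) w'(5-10) \<open>c = c'\<close> by (intro w'(11)[OF w(3)]) auto
          then show False using 2 w(5-10) w'(5-10) \<open>c = c'\<close> by auto
        qed
      qed
      then have "d = d'" by (rule eqx[OF w(3) w'(3)])
      have "snd a = snd a'"
      proof (rule ccontr)
        assume "snd a \<noteq> snd a'"
        then consider "snd a < snd a'" | "snd a' < snd a" by linarith
        then show False
        proof cases
          case 1
          then have "a' = a \<or> a' = c \<or> a' = d \<or> a' = b"
            using w(5-10) w'(5-10) \<open>c = c'\<close> \<open>d = d'\<close> by (intro w(11)[OF w'(1)]) auto
          then show False using 1 w(5-10) w'(5-10) \<open>c = c'\<close> \<open>d = d'\<close> by auto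
        next
          case 2
          then have "a = a' \<or> a = c' \<or> a = d' \<or> a = b"
            using w(5-10) w'(5-10) \<open>c = c'\<close> \<open>d = d'\<close> by (intro w'(11)[OF w(1)]) auto
          then show False using 2 w(5-10) w'(5-10) \<open>c = c'\<close> \<open>d = d'\<close> by auto
        qed
      qed
      then have "a = a'" by (rule eqy[OF w(1) w'(1)])
      then show "z = z'" using z \<open>c = c'\<close> \<open>d = d'\<close> by simp
    qed
    also have "\<dots> \<le> mix_value (?L b) (?R b)"
      using finLR disj by (rule card_ascents_le_mix_value)
    finally show "card (?W b) \<le> mix_value (?L b) (?R b)" .
  qed
  finally show ?thesis by (simp add: funnel_def)
qed

section \<open>Rotation by 180 degrees\<close>

definition neg :: "point \<Rightarrow> point" where
  "neg p = (- fst p, - snd p)"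

lemma neg_simps [simp]: "fst (neg p) = - fst p" "snd (neg p) = - snd p" "neg (neg p) = p"
  by (simp_all add: neg_def)

lemma neg_eq_iff: "neg p = q \<longleftrightarrow> p = neg q"
  by (metis neg_simps(3))

lemma box_free_neg: "box_free (neg ` P) x1 x2 y1 y2 \<longleftrightarrow> box_free P (- x2) (- x1) (- y2) (- y1)"
  by (auto simp: box_free_def)

text \<open>Reversing both axes preserves the shape while swapping \<open>a\<close> with
  \<open>b\<close> and \<open>c\<close> with \<open>d\<close>.\<close>

lemma pinwheels_neg:
  assumes "(a, c, d, b) \<in> pinwheels (neg ` P)"
  shows "(neg b, neg d, neg c, neg a) \<in> pinwheels P"
proof -
  note w = pinwheelsD[OF assms]
  have mem: "neg q \<in> P" if "q \<in> neg ` P" for q using that by auto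
  have "q \<in> {neg b, neg d, neg c, neg a}"
    if "q \<in> P" "fst (neg c) \<le> fst q" "fst q \<le> fst (neg d)" "snd (neg b) \<le> snd q" "snd q \<le> snd (neg a)" for q
  proof -
    have "neg q = a \<or> neg q = c \<or> neg q = d \<or> neg q = b"
      using that by (intro w(11)) auto
    then show ?thesis by (auto simp: neg_eq_iff)
  qed
  then show ?thesis
    using w(5-10) mem[OF w(1)] mem[OF w(2)] mem[OF w(3)] mem[OF w(4)] unfolding pinwheels_def by simp
qed

lemma pinwheel_starting_at:
  assumes fin: "finite P" and inj: "inj_on fst P" "inj_on snd P"
    and P: "a \<in> P" "b \<in> P" "c \<in> P" "d \<in> P"
    and x: "fst d < fst a" "fst a < fst b" "fst b < fst c"
    and y: "snd a < snd c" "snd c < snd d" "snd d < snd b"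
    and f1: "box_free P (fst a) (fst b) (snd a) (snd b)"
    and f2: "box_free P (fst d) (fst c) (snd a) (snd c)"
  obtains b' c' d' where "(a, c', d', b') \<in> pinwheels P" "snd c < snd b'" "snd b' \<le> snd b"
proof -
  have inj': "inj_on fst (neg ` P)" "inj_on snd (neg ` P)"
    using inj by (auto simp: inj_on_def)
  obtain a' c' d' where w: "(a', c', d', neg a) \<in> pinwheels (neg ` P)"
    "snd (neg b) \<le> snd a'" "snd a' < snd (neg c)"
    by (rule pinwheel_ending_at[of "neg ` P" "neg b" "neg a" "neg d" "neg c"])
      (use fin inj' P x y f1 f2 in \<open>auto simp: box_free_neg\<close>)
  show thesis
    using that[of "neg d'" "neg c'" "neg a'"] pinwheels_neg[OF w(1)] w(2,3) by simp
qed

section \<open>Charging crossings to pinwheels\<close>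

lemma card_crossings_le:
  assumes fin: "finite P" and inj: "inj_on fst P" "inj_on snd P" and G: "gapless P T"
  shows "card (crossings P T) \<le> 2 * card P + 2 * card (pinwheels P)"
proof -
  have eqy: "q = r" if "q \<in> P" "r \<in> P" "snd q = snd r" for q r by (rule inj_onD[OF inj(2) that(3,1,2)])
  define E where "E = crossings P T"
  define W where "W = pinwheels P"
  have EP: "a \<in> P" "b \<in> P" "snd a < snd b" if "(a, b) \<in> E" for a b
    using crossingsD that unfolding E_def by blast+
  have finE: "finite E" unfolding E_def using fin by (rule finite_crossings)
  have finW: "finite W" unfolding W_def using fin by (rule finite_pinwheels)
  \<comment> \<open>The pinwheel ends at \<open>b\<close> and starts no earlier than
    \<open>a\<close> but before every later start of a crossing into \<open>b\<close>.
    \<open>R4\<close> is the rotated condition.\<close>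
  define R3 :: "point \<times> point \<Rightarrow> point \<times> point \<times> point \<times> point \<Rightarrow> bool" where
    "R3 = (\<lambda>(a, b) z. \<exists>a' c' d'. z = (a', c', d', b) \<and> snd a \<le> snd a' \<and>
    (\<forall>d. (d, b) \<in> E \<longrightarrow> snd a < snd d \<longrightarrow> snd a' < snd d))"
  define R4 :: "point \<times> point \<Rightarrow> point \<times> point \<times> point \<times> point \<Rightarrow> bool" where
    "R4 = (\<lambda>(a, b) z. \<exists>b' c' d'. z = (a, c', d', b') \<and> snd b' \<le> snd b \<and>
    (\<forall>c. (a, c) \<in> E \<longrightarrow> snd c < snd b \<longrightarrow> snd c < snd b'))"
  define E1 where "E1 = {(a, b) \<in> E. \<forall>d. (d, b) \<in> E \<longrightarrow> snd d \<le> snd a}"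
  define E2 where "E2 = {(a, b) \<in> E. \<forall>c. (a, c) \<in> E \<longrightarrow> snd b \<le> snd c}"
  define E3 where "E3 = {e \<in> E. \<exists>z\<in>W. R3 e z}"
  define E4 where "E4 = {e \<in> E. \<exists>z\<in>W. R4 e z}"
  have "card E1 \<le> card P"
  proof (rule card_le_if_inj_on_rel[OF fin, where r = "\<lambda>e p. p = snd e"])
    fix e e' p assume *: "e \<in> E1" "e' \<in> E1" "p = snd e" "p = snd e'"
    obtain a a' b where e: "e = (a, b)" "e' = (a', b)" using * by (metis prod.collapse)
    then have "(a, b) \<in> E" "(a', b) \<in> E" "snd a \<le> snd a'" "snd a' \<le> snd a"
      using * unfolding E1_def by blast+
    then show "e = e'" using eqy[of a a'] EP e by auto
  qed (use EP in \<open>auto simp: E1_def\<close>)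
  moreover have "card E2 \<le> card P"
  proof (rule card_le_if_inj_on_rel[OF fin, where r = "\<lambda>e p. p = fst e"])
    fix e e' p assume *: "e \<in> E2" "e' \<in> E2" "p = fst e" "p = fst e'"
    obtain a b b' where e: "e = (a, b)" "e' = (a, b')" using * by (metis prod.collapse)
    then have "(a, b) \<in> E" "(a, b') \<in> E" "snd b \<le> snd b'" "snd b' \<le> snd b"
      using * unfolding E2_def by blast+
    then show "e = e'" using eqy[of b b'] EP e by auto
  qed (use EP in \<open>auto simp: E2_def\<close>)
  moreover have "card E3 \<le> card W"
  proof (rule card_le_if_inj_on_rel[OF finW, where r = R3])
    fix e e' z assume *: "e \<in> E3" "e' \<in> E3" "R3 e z" "R3 e' z"
    obtain a a' b where e: "e = (a, b)" "e' = (a', b)"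
      using *(3,4) unfolding R3_def by auto
    have E: "(a, b) \<in> E" "(a', b) \<in> E" using * e unfolding E3_def by auto
    \<comment> \<open>If \<open>a\<close> were earlier than \<open>a'\<close>, the pinwheel would
      start before \<open>a'\<close> by the first charge and not before \<open>a'\<close> by the
      second.\<close>
    then have "\<not> snd a < snd a'" "\<not> snd a' < snd a"
      using *(3,4) unfolding R3_def e by fastforce+
    then show "e = e'" using eqy[of a a'] EP E e by auto
  qed (unfold E3_def, blast)
  moreover have "card E4 \<le> card W"
  proof (rule card_le_if_inj_on_rel[OF finW, where r = R4])
    fix e e' z assume *: "e \<in> E4" "e' \<in> E4" "R4 e z" "R4 e' z"
    obtain a b b' where e: "e = (a, b)" "e' = (a, b')"
      using *(3,4) unfolding R4_def by auto
    have E: "(a, b) \<in> E" "(a, b') \<in> E" using * e unfolding E4_def by auto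
    then have "\<not> snd b < snd b'" "\<not> snd b' < snd b"
      using *(3,4) unfolding R4_def e by fastforce+
    then show "e = e'" using eqy[of b b'] EP E e by auto
  qed (unfold E4_def, blast)
  moreover have "E \<subseteq> E1 \<union> E2 \<union> (E3 \<union> E4)"
  proof
    fix e assume "e \<in> E"
    then obtain a b where e: "e = (a, b)" "(a, b) \<in> E" by (cases e) auto
    show "e \<in> E1 \<union> E2 \<union> (E3 \<union> E4)"
    proof (cases "e \<in> E1 \<union> E2")
      case False
      then obtain d0 c0 where dc0: "(d0, b) \<in> E" "snd a < snd d0" "(a, c0) \<in> E" "snd c0 < snd b"
        using e unfolding E1_def E2_def by (auto simp: not_le)
      let ?D = "{d \<in> P. (d, b) \<in> E \<and> snd a < snd d}" and ?C = "{c \<in> P. (a, c) \<in> E \<and> snd c < snd b}"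
      have "\<exists>d\<in>?D. \<forall>q\<in>?D. snd d \<le> snd q"
        by (rule finite_ex_minimizer[of _ d0]) (use fin dc0 EP in auto)
      then obtain d where d: "(d, b) \<in> E" "snd a < snd d"
        "\<And>q. (q, b) \<in> E \<Longrightarrow> snd a < snd q \<Longrightarrow> snd d \<le> snd q"
        using EP by blast
      have "\<exists>c\<in>?C. \<forall>q\<in>?C. - snd c \<le> - snd q"
        by (rule finite_ex_minimizer[of _ c0 "\<lambda>q. - snd q"]) (use fin dc0 EP in auto)
      then obtain c where c: "(a, c) \<in> E" "snd c < snd b"
        "\<And>q. (a, q) \<in> E \<Longrightarrow> snd q < snd b \<Longrightarrow> snd q \<le> snd c"
        using EP unfolding neg_le_iff_le by blast
      note P = EP(1,2)[OF e(2)] EP(2)[OF c(1)] EP(1)[OF d(1)]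
      have ab: "fst a < fst b" "box_free P (fst a) (fst b) (snd a) (snd b)"
        using crossings_box_free[OF G] e(2) unfolding E_def by blast+
      have ac: "fst a < fst c" "snd a < snd c"
        using crossings_box_free[OF G] EP c(1) unfolding E_def by blast+
      have db: "fst d < fst b" "snd d < snd b"
        using crossings_box_free[OF G] EP d(1) unfolding E_def by blast+
      \<comment> \<open>\<open>d\<close> has time strictly between \<open>a\<close> and
        \<open>b\<close> and key below \<open>b\<close>, so the empty box of \<open>(a, b)\<close>
        pushes it left of \<open>a\<close>; likewise \<open>c\<close> is right of
        \<open>b\<close>.\<close>
      have x: "fst d < fst a" "fst b < fst c"
        using ab(2) P ac db c(2) d(2) unfolding box_free_def by (meson less_imp_le not_le)+
      have ne: "snd c \<noteq> snd d" using eqy[of c d] P x ab(1) by auto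
      have "box_free P (fst d) (fst c) (snd d) (snd b) \<or> box_free P (fst d) (fst c) (snd a) (snd c)"
        using crossings_nested_box_free[OF G] e(2) d(1,2) c(1,2) unfolding E_def by blast
      then have "e \<in> E3 \<or> e \<in> E4"
      proof
        assume f: "box_free P (fst d) (fst c) (snd d) (snd b)"
        \<comment> \<open>A later \<open>c\<close> would lie on the right edge of the empty box
          \<open>f\<close>.\<close>
        then have "\<not> snd d < snd c" using P x ab(1) c(2) unfolding box_free_def by fastforce
        then have "snd c < snd d" using ne by simp
        then obtain a' c' d' where "(a', c', d', b) \<in> W" "snd a \<le> snd a'" "snd a' < snd d"
          using pinwheel_ending_at[OF fin inj P x(1) ab(1) x(2) ac(2) _ db(2) ab(2) f]
          unfolding W_def by blast
        then have "R3 e (a', c', d', b)" using d(3) unfolding R3_def e(1) by fastforce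
        then show ?thesis using \<open>(a', c', d', b) \<in> W\<close> \<open>e \<in> E\<close> unfolding E3_def by blast
      next
        assume f: "box_free P (fst d) (fst c) (snd a) (snd c)"
        \<comment> \<open>Here an earlier \<open>d\<close> would lie on the left edge of the empty
          box.\<close>
        then have "\<not> snd d < snd c" using P x ab(1) d(2) unfolding box_free_def by fastforce
        then have "snd c < snd d" using ne by simp
        then obtain b' c' d' where "(a, c', d', b') \<in> W" "snd c < snd b'" "snd b' \<le> snd b"
          using pinwheel_starting_at[OF fin inj P x(1) ab(1) x(2) ac(2) _ db(2) ab(2) f]
          unfolding W_def by blast
        then have "R4 e (a, c', d', b')" using c(3) unfolding R4_def e(1) by fastforce
        then show ?thesis using \<open>(a, c', d', b') \<in> W\<close> \<open>e \<in> E\<close> unfolding E4_def by blast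
      qed
      then show ?thesis by blast
    qed blast
  qed
  moreover have "finite (E1 \<union> E2 \<union> (E3 \<union> E4))"
    by (rule finite_subset[OF _ finE]) (auto simp: E1_def E2_def E3_def E4_def)
  ultimately have "card E \<le> card (E1 \<union> E2 \<union> (E3 \<union> E4))" by (intro card_mono)
  also have "\<dots> \<le> (card E1 + card E2) + (card E3 + card E4)"
    by (meson add_mono card_Un_le le_trans)
  finally show ?thesis
    using \<open>card E1 \<le> card P\<close> \<open>card E2 \<le> card P\<close> \<open>card E3 \<le> card W\<close> \<open>card E4 \<le> card W\<close>
    unfolding E_def W_def by linarith
qed

section \<open>Assembling the bounds\<close>

lemma alt_le_funnel:
  assumes fin: "finite P" and inj: "inj_on fst P" "inj_on snd P" and T: "reference_tree T P"
  shows "alt T P \<le> 4 * funnel P + 6 * card P"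
proof -
  have so: "sorted_wrt (<) (leaves T)" and set: "set (leaves T) = fst ` P"
    using T by (auto simp: reference_tree_def)
  have "length (leaves T) = card P"
    using so set inj(1) by (metis card_image distinct_card strict_sorted_iff)
  moreover have "alt T P + 2 \<le> 2 * card (crossings P T) + 2 * length (leaves T)"
    by (rule alt_le_card_crossings[OF fin inj(2) so]) (use set in auto)
  moreover have "gapless P T" using so set by (auto simp: gapless_def)
  then have "card (crossings P T) \<le> 2 * card P + 2 * card (pinwheels P)"
    by (rule card_crossings_le[OF fin inj])
  moreover have "card (pinwheels P) \<le> funnel P"
    by (rule card_pinwheels_le_funnel[OF fin inj])
  \<comment> \<open>Doubling the bound on crossings gives \<open>4 * funnel P + 4 * card P\<close>;
    the inner nodes add at most \<open>2 * card P\<close>.\<close>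
  ultimately show ?thesis by linarith
qed

lemma points_eq_image: "points X = (\<lambda>i. (real (X ! i), real (Suc i))) ` {..<length X}"
proof -
  have "{1..length X} = Suc ` {..<length X}" by (simp add: image_Suc_lessThan)
  then have "points X = (\<lambda>i. (real (X ! (i - 1)), real i)) ` Suc ` {..<length X}"
    unfolding points_def by blast
  then show ?thesis by (simp add: image_image)
qed

theorem theorem1:
  shows "\<exists>C::real. C > 0 \<and>
    (\<forall>(n::nat) (m::nat) (X::nat list) (T::leaf_tree).
      length X = m \<longrightarrow> set X \<subseteq> {1..n} \<longrightarrow> distinct X \<longrightarrow> reference_tree T (points X) \<longrightarrow>
      real (alt T (points X)) \<le> C * (real (funnel (points X)) + real m))"
proof (intro exI[of _ 6] conjI allI impI)
  fix n m :: nat and X :: "nat list" and T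
  assume m: "length X = m" and X: "distinct X" and T: "reference_tree T (points X)"
  have "finite (points X)" by (simp add: points_eq_image)
  \<comment> \<open>Distinct keys enter here.\<close>
  moreover have "inj_on fst (points X)"
    using X by (auto simp: points_eq_image inj_on_def nth_eq_iff_index_eq)
  moreover have "inj_on snd (points X)" by (auto simp: points_eq_image inj_on_def)
  ultimately have "alt T (points X) \<le> 4 * funnel (points X) + 6 * card (points X)"
    using T by (rule alt_le_funnel)
  also have "\<dots> \<le> 6 * (funnel (points X) + m)"
    using card_image_le[of "{..<length X}" "\<lambda>i. (real (X ! i), real (Suc i))"] m
    by (simp add: points_eq_image)
  finally have "real (alt T (points X)) \<le> real (6 * (funnel (points X) + m))"
    by (rule of_nat_mono)
  then show "real (alt T (points X)) \<le> 6 * (real (funnel (points X)) + real m)" by simp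
qed simp

end
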